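(* Let $\delta>0$ and let $(X,d,\mu)$ be an Ahlfors $\delta$-regular metric-measure space, with associated form $\mathcal E$. There is a constant $C>0$, independent of $h$ and $f$, such that for every Dini continuous function $h\in\operatorname{Din}(X,d)$ and every $f\in\operatorname{Dom}\mathcal E$ one has $hf\in\operatorname{Dom}\mathcal E$ and $$\|hf\|_{\mathcal E}\le C\,\|h\|_{\operatorname{Din}}\,\|f\|_{\mathcal E}.$$
   Context: A metric-measure space is a triple $(X,d,\mu)$ where $(X,d)$ is a locally compact second-countable metric space and $\mu$ is a finite Borel measure on $X$. It is Ahlfors $\delta$-regular ($\delta>0$) if there is $C\ge 1$ such that $C^{-1}r^\delta\le\mu(\overline B(x,r))\le Cr^\delta$ for all $x\in X$ and $0\le r<\operatorname{diam}X$; then $\operatorname{diam} X<\infty$. $L^2(X,\mu)$ denotes the real Hilbert space of real-valued square-integrable functions. Define $$\operatorname{Dom}\mathcal E=\Big\{f\in L^2(X,\mu):\int_X\int_X\frac{|f(x)-f(y)|^2}{d(x,y)^\delta}\,d\mu(y)\,d\mu(x)<\infty\Big\},$$ $$\mathcal E(f,g)=\frac12\int_X\int_X\frac{(f(x)-f(y))(g(x)-g(y))}{d(x,y)^\delta}\,d\mu(y)\,d\mu(x),\qquad f,g\in\operatorname{Dom}\mathcal E,$$ the integrals being over the complement of the diagonal in $X\times X$, and $\|f\|_{\mathcal E}^2=\|f\|_{L^2}^2+\mathcal E(f,f)$. A bounded uniformly continuous function $h:X\to\mathbb R$ is Dini continuous if $\operatorname{Din}(h):=\int_0^1\frac{\omega_h(t)}{t}\,dt<\infty$,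 where $\omega_h(t)=\sup\{|h(x)-h(y)|:d(x,y)\le t\operatorname{diam}(X)\}$ for $t\in[0,1]$. $\operatorname{Din}(X,d)$ is the set of Dini continuous functions, with Dini norm $\|h\|_{\operatorname{Din}}=\|h\|_\infty+\operatorname{Din}(h)$. *)

theory Defs
  imports "HOL-Analysis.Analysis"
begin

text \<open>The metric space \<open>X\<close> is the whole type \<open>'a\<close>; second countability is imposed by a type class.\<close>

definition metric_measure_space :: "'a::{metric_space, second_countable_topology} measure \<Rightarrow> bool" where
  "metric_measure_space M \<longleftrightarrow>
     locally compact (UNIV :: 'a set) \<and> finite_measure M \<and> sets M = sets borel"

text \<open>The library's real-valued \<open>diameter\<close> is only meaningful for bounded sets, whereas boundedness
  of an Ahlfors regular space is a consequence of the definition and not part of it.\<close>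

definition ediam :: "'a::metric_space set \<Rightarrow> ennreal" where
  "ediam S = (SUP (x, y)\<in>S \<times> S. ennreal (dist x y))"

lemma ediam_eq_diameter:
  assumes "bounded S"
  shows "ediam S = ennreal (diameter S)"
proof (cases "S = {}")
  case True
  then show ?thesis by (simp add: ediam_def diameter_def bot_ennreal)
next
  case False
  have "ediam S \<le> ennreal (diameter S)"
    unfolding ediam_def
    by (rule SUP_least) (auto intro!: ennreal_leI diameter_bounded_bound assms)
  moreover have "ennreal (diameter S) \<le> ediam S"
  proof (cases "ediam S")
    case (real r)
    have "dist x y \<le> r" if "x \<in> S" "y \<in> S" for x y
    proof -
      have "ennreal (dist x y) \<le> ediam S"
        unfolding ediam_def by (rule SUP_upper2[of "(x, y)"]) (use that in auto)
      then show ?thesis using real by simp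
    qed
    then have "diameter S \<le> r"
      using False by (auto simp: diameter_def intro!: cSUP_least)
    then show ?thesis using real by (simp add: ennreal_leI)
  qed simp
  ultimately show ?thesis by (rule antisym)
qed

definition ahlfors_regular ::
  "real \<Rightarrow> 'a::{metric_space, second_countable_topology} measure \<Rightarrow> bool" where
  "ahlfors_regular \<delta> M \<longleftrightarrow>
     (\<exists>C\<ge>1. \<forall>x::'a. \<forall>r\<ge>0. ennreal r < ediam (UNIV :: 'a set) \<longrightarrow>
        inverse C * r powr \<delta> \<le> measure M (cball x r) \<and> measure M (cball x r) \<le> C * r powr \<delta>)"

text \<open>Elements of \<open>L\<^sup>2\<close> are represented by functions; the domain, the form and the norms do not
  distinguish measurable functions that agree almost everywhere.\<close>

definition L2_space :: "'a measure \<Rightarrow> ('a \<Rightarrow> real) set" where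
  "L2_space M = {f. f \<in> borel_measurable M \<and> integrable M (\<lambda>x. (f x)\<^sup>2)}"

definition L2_norm :: "'a measure \<Rightarrow> ('a \<Rightarrow> real) \<Rightarrow> real" where
  "L2_norm M f = sqrt (\<integral>x. (f x)\<^sup>2 \<partial>M)"

definition form_dom :: "real \<Rightarrow> 'a::metric_space measure \<Rightarrow> ('a \<Rightarrow> real) set" where
  "form_dom \<delta> M = {f \<in> L2_space M.
     (\<integral>\<^sup>+x. (\<integral>\<^sup>+y\<in>-{x}. ennreal (\<bar>f x - f y\<bar>\<^sup>2 / dist x y powr \<delta>) \<partial>M) \<partial>M) < \<infinity>}"

definition form :: "real \<Rightarrow> 'a::metric_space measure \<Rightarrow> ('a \<Rightarrow> real) \<Rightarrow> ('a \<Rightarrow> real) \<Rightarrow> real" where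
  "form \<delta> M f g =
     1 / 2 * (\<integral>x. (LINT y:-{x}|M. (f x - f y) * (g x - g y) / dist x y powr \<delta>) \<partial>M)"

definition form_norm :: "real \<Rightarrow> 'a::metric_space measure \<Rightarrow> ('a \<Rightarrow> real) \<Rightarrow> real" where
  "form_norm \<delta> M f = sqrt ((L2_norm M f)\<^sup>2 + form \<delta> M f f)"

definition modulus_cont :: "('a::metric_space \<Rightarrow> real) \<Rightarrow> real \<Rightarrow> real" where
  "modulus_cont h t =
     Sup {\<bar>h x - h y\<bar> | x y. ennreal (dist x y) \<le> ennreal t * ediam (UNIV :: 'a set)}"

definition Din :: "('a::metric_space \<Rightarrow> real) \<Rightarrow> ennreal" where
  "Din h = (\<integral>\<^sup>+t\<in>{0<..1}. ennreal (modulus_cont h t / t) \<partial>lborel)"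

definition dini_continuous :: "('a::metric_space \<Rightarrow> real) \<Rightarrow> bool" where
  "dini_continuous h \<longleftrightarrow> bounded (range h) \<and> uniformly_continuous_on UNIV h \<and> Din h < \<infinity>"

definition dini_norm :: "('a::metric_space \<Rightarrow> real) \<Rightarrow> real" where
  "dini_norm h = (SUP x. \<bar>h x\<bar>) + enn2real (Din h)"

end

theory Submission
  imports Defs
begin

text \<open>Writing \<open>h x * f x - h y * f y = h y * (f x - f y) + f x * (h x - h y)\<close> and squaring bounds
  the energy of \<open>h f\<close> by two terms. The first is at most twice the square of the supremum of
  \<open>\<bar>h\<bar>\<close> times the energy of \<open>f\<close>. Integrated over \<open>y\<close> first, the second is twice the integral of \<open>(f x)\<^sup>2\<close> against
  \<open>K x = \<integral> (h x - h y)\<^sup>2 / dist x y powr \<delta> \<partial>M(y)\<close>, so everything rests on bounding \<open>K\<close> uniformly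
  by a constant times the square of the Dini norm (\<open>nn_integral_square_kernel_le\<close>).

  One factor \<open>\<bar>h x - h y\<bar>\<close> in \<open>K\<close> is estimated by twice the supremum. For the other, the space is
  cut into annuli around \<open>x\<close> whose radii halve at each step, starting from the diameter \<open>D\<close>. On the
  annulus of outer radius \<open>(1/2) ^ n * D\<close> the increment is at most the modulus of continuity at
  \<open>(1/2) ^ n\<close>, while regularity says that the mass of the annulus is cancelled by the kernel
  \<open>dist x y powr -\<delta>\<close> up to a constant (\<open>nn_integral_kernel_le\<close>). There remains the sum of the modulus
  over the dyadic scales, which the Dini integral dominates because the modulus is monotone
  (\<open>suminf_modulus_cont_le\<close>).

  Estimates are carried out for the extended nonnegative \<open>energy\<close>, where
  infinite values do no harm; \<open>form_eq_energy\<close> transfers them to the form.\<close>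

section \<open>Dyadic decompositions\<close>

lemma dyadic_scale_exists:
  fixes s :: real
  assumes "0 < s" "s \<le> 1"
  obtains n :: nat where "(1/2) ^ Suc n < s" "s \<le> (1/2) ^ n"
proof -
  have ex: "\<exists>n. (1/2) ^ Suc n < s"
  proof -
    obtain n where n: "(1/2::real) ^ n < s"
      using real_arch_pow_inv[of s "1/2"] assms by auto
    have "(1/2::real) ^ Suc n \<le> (1/2) ^ n"
      by (rule power_decreasing) auto
    with n show ?thesis by (intro exI[of _ n]) linarith
  qed
  define m where "m = (LEAST n. (1/2) ^ Suc n < s)"
  have m: "(1/2) ^ Suc m < s"
    unfolding m_def by (rule LeastI_ex[OF ex])
  have "s \<le> (1/2) ^ m"
  proof (cases m)
    case (Suc k)
    then have "\<not> (1/2) ^ Suc k < s"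
      using not_less_Least[of k "\<lambda>n. (1/2) ^ Suc n < s"] unfolding m_def by simp
    with Suc show ?thesis by simp
  qed (use assms in simp)
  with m that show thesis by blast
qed

text \<open>On the dyadic interval from \<open>(1/2) ^ Suc n\<close> to \<open>(1/2) ^ n\<close> the integrand is at least
  \<open>w ((1/2) ^ Suc n) * 2 ^ n\<close>, and the interval has length \<open>(1/2) ^ Suc n\<close>, so it contributes at
  least half of the \<open>n\<close>-th summand. Comparing with \<open>1 / t\<close> at the right end point avoids
  logarithms.\<close>

lemma suminf_dyadic_le_nn_integral:
  fixes w :: "real \<Rightarrow> real"
  assumes nonneg: "\<And>t. 0 \<le> t \<Longrightarrow> 0 \<le> w t"
    and mono: "\<And>s t. 0 \<le> s \<Longrightarrow> s \<le> t \<Longrightarrow> w s \<le> w t"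
  shows "(\<Sum>n. ennreal (w ((1/2) ^ Suc n))) \<le> 2 * (\<integral>\<^sup>+t\<in>{0<..1}. ennreal (w t / t) \<partial>lborel)"
proof -
  define I where "I n = {(1/2::real) ^ Suc n<..(1/2) ^ n}" for n :: nat
  define c where "c n = ennreal (w ((1/2) ^ Suc n) * 2 ^ n)" for n :: nat
  have disj: "disjoint_family I"
  proof -
    have "I m \<inter> I n = {}" if "m < n" for m n
    proof -
      have "(1/2::real) ^ n \<le> (1/2) ^ Suc m"
        by (rule power_decreasing) (use that in auto)
      then show ?thesis by (force simp: I_def simp del: power_Suc)
    qed
    then show ?thesis
      unfolding disjoint_family_on_def by (metis inf_commute linorder_neqE_nat)
  qed
  have "(\<Sum>n. ennreal (w ((1/2) ^ Suc n))) = (\<Sum>n. 2 * (c n * emeasure lborel (I n)))"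
  proof (intro suminf_cong)
    fix n
    have "emeasure lborel (I n) = ennreal ((1/2) ^ Suc n)"
      unfolding I_def by (subst emeasure_lborel_Ioc) auto
    moreover have "2 * (ennreal a * ennreal b) = ennreal (2 * (a * b))" if "0 \<le> a" "0 \<le> b" for a b
      using that by (simp add: ennreal_mult)
    ultimately have "2 * (c n * emeasure lborel (I n))
        = ennreal (2 * (w ((1/2) ^ Suc n) * 2 ^ n * (1/2) ^ Suc n))"
      unfolding c_def using nonneg[of "(1/2) ^ Suc n"] by (simp del: power_Suc)
    also have "2 * (w ((1/2) ^ Suc n) * 2 ^ n * (1/2) ^ Suc n) = w ((1/2) ^ Suc n)"
      by (simp add: power_one_over field_simps)
    finally show "ennreal (w ((1/2) ^ Suc n)) = 2 * (c n * emeasure lborel (I n))" by simp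
  qed
  also have "\<dots> = 2 * (\<Sum>n. \<integral>\<^sup>+t. c n * indicator (I n) t \<partial>lborel)"
    by (simp add: ennreal_suminf_cmult nn_integral_cmult_indicator I_def)
  also have "(\<Sum>n. \<integral>\<^sup>+t. c n * indicator (I n) t \<partial>lborel)
      = (\<integral>\<^sup>+t. (\<Sum>n. c n * indicator (I n) t) \<partial>lborel)"
    by (rule nn_integral_suminf[symmetric]) (simp add: I_def)
  also have "\<dots> \<le> (\<integral>\<^sup>+t\<in>{0<..1}. ennreal (w t / t) \<partial>lborel)"
  proof (intro nn_integral_mono)
    fix t :: real
    show "(\<Sum>n. c n * indicator (I n) t) \<le> ennreal (w t / t) * indicator {0<..1} t"
    \<comment> \<open>The intervals are disjoint, so at most one summand is nonzero.\<close>
    proof (cases "\<exists>n. t \<in> I n")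
      case True
      then obtain n where n: "t \<in> I n" by blast
      then have lo: "(1/2) ^ Suc n < t" and hi: "t \<le> (1/2) ^ n"
        by (auto simp: I_def)
      have "0 < (1/2::real) ^ Suc n" by (rule zero_less_power) simp
      with lo have t: "0 < t" by linarith
      have "(1/2::real) ^ n \<le> 1" by (rule power_le_one) auto
      with hi t have ind: "t \<in> {0<..1}" by simp
      have "w ((1/2) ^ Suc n) \<le> w t"
        by (rule mono) (use lo in auto)
      moreover have "2 ^ n \<le> 1 / t"
        using hi t by (simp add: power_one_over field_simps)
      ultimately have "w ((1/2) ^ Suc n) * 2 ^ n \<le> w t * (1 / t)"
        by (intro mult_mono nonneg) (use t in auto)
      then show ?thesis
        unfolding suminf_cmult_indicator[OF disj n] c_def
        using ind by (simp add: ennreal_leI)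
    qed simp
  qed
  finally show ?thesis by (simp add: mult_left_mono)
qed

section \<open>The modulus of continuity\<close>

lemma dist_le_scaled_ediam_iff:
  assumes "ediam (UNIV :: 'a::metric_space set) = ennreal D" "0 \<le> D" "0 \<le> t"
  shows "ennreal (dist (x::'a) y) \<le> ennreal t * ediam (UNIV :: 'a set) \<longleftrightarrow> dist x y \<le> t * D"
  using assms by (simp add: flip: ennreal_mult)

lemma abs_diff_le_bound:
  fixes h :: "'a \<Rightarrow> real"
  assumes "\<And>x. \<bar>h x\<bar> \<le> S"
  shows "\<bar>h x - h y\<bar> \<le> 2 * S"
  using assms[of x] assms[of y] by linarith

text \<open>The modulus of continuity is a supremum of reals, so it carries information only once the set of
  increments is known to be bounded.\<close>

lemma bdd_above_modulus_set:
  fixes h :: "'a::metric_space \<Rightarrow> real"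
  assumes "\<And>x. \<bar>h x\<bar> \<le> S"
  shows "bdd_above {\<bar>h x - h y\<bar> | x y. P x y}"
  using abs_diff_le_bound[of h, OF assms] by (intro bdd_aboveI[of _ "2 * S"]) auto

lemma abs_diff_le_modulus_cont:
  fixes h :: "'a::metric_space \<Rightarrow> real"
  assumes "\<And>x. \<bar>h x\<bar> \<le> S"
    and "ennreal (dist x y) \<le> ennreal t * ediam (UNIV :: 'a set)"
  shows "\<bar>h x - h y\<bar> \<le> modulus_cont h t"
  unfolding modulus_cont_def
  by (rule cSup_upper[OF _ bdd_above_modulus_set[of h, OF assms(1)]]) (use assms(2) in auto)

lemma modulus_cont_nonneg:
  fixes h :: "'a::metric_space \<Rightarrow> real"
  assumes "\<And>x. \<bar>h x\<bar> \<le> S"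
  shows "0 \<le> modulus_cont h t"
  using abs_diff_le_modulus_cont[of h S undefined undefined t] assms by simp

lemma modulus_cont_le:
  fixes h :: "'a::metric_space \<Rightarrow> real"
  assumes "\<And>x. \<bar>h x\<bar> \<le> S"
  shows "modulus_cont h t \<le> 2 * S"
  unfolding modulus_cont_def
proof (rule cSup_least)
  have "ennreal (dist (undefined::'a) undefined) \<le> ennreal t * ediam (UNIV :: 'a set)"
    by simp
  then show "{\<bar>h x - h y\<bar> | x y. ennreal (dist x y) \<le> ennreal t * ediam (UNIV :: 'a set)} \<noteq> {}"
    by blast
qed (use abs_diff_le_bound[of h, OF assms] in auto)

lemma modulus_cont_mono:
  fixes h :: "'a::metric_space \<Rightarrow> real"
  assumes "\<And>x. \<bar>h x\<bar> \<le> S" "s \<le> t"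
  shows "modulus_cont h s \<le> modulus_cont h t"
  unfolding modulus_cont_def
proof (rule cSup_subset_mono[OF _ bdd_above_modulus_set[of h, OF assms(1)]])
  have "ennreal (dist (undefined::'a) undefined) \<le> ennreal s * ediam (UNIV :: 'a set)"
    by simp
  then show "{\<bar>h x - h y\<bar> | x y. ennreal (dist x y) \<le> ennreal s * ediam (UNIV :: 'a set)} \<noteq> {}"
    by blast
  have "ennreal s * ediam (UNIV :: 'a set) \<le> ennreal t * ediam (UNIV :: 'a set)"
    by (intro mult_right_mono ennreal_leI assms) simp
  then show "{\<bar>h x - h y\<bar> | x y. ennreal (dist x y) \<le> ennreal s * ediam (UNIV :: 'a set)}
      \<subseteq> {\<bar>h x - h y\<bar> | x y. ennreal (dist x y) \<le> ennreal t * ediam (UNIV :: 'a set)}"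
    by (blast intro: order_trans)
qed

text \<open>The scale \<open>1\<close> is not reached by the dyadic comparison, which bounds the modulus at the left
  end points of the intervals. It is the one term that the supremum of \<open>\<bar>h\<bar>\<close> has to pay for.\<close>

lemma suminf_modulus_cont_le:
  fixes h :: "'a::metric_space \<Rightarrow> real"
  assumes "\<And>x. \<bar>h x\<bar> \<le> S"
  shows "(\<Sum>n. ennreal (modulus_cont h ((1/2) ^ n))) \<le> 2 * (ennreal S + Din h)"
proof -
  have S: "0 \<le> S" using assms[of undefined] by linarith
  have "(\<Sum>n. ennreal (modulus_cont h ((1/2) ^ n)))
      = ennreal (modulus_cont h 1) + (\<Sum>n. ennreal (modulus_cont h ((1/2) ^ Suc n)))"
    using suminf_offset[of "\<lambda>n. ennreal (modulus_cont h ((1/2) ^ n))" 1]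
    by (simp add: add.commute)
  also have "\<dots> \<le> ennreal (2 * S) + 2 * Din h"
    unfolding Din_def
    by (intro add_mono ennreal_leI modulus_cont_le suminf_dyadic_le_nn_integral
        modulus_cont_nonneg modulus_cont_mono) (use assms in auto)
  also have "\<dots> = 2 * (ennreal S + Din h)"
    using S by (simp add: ennreal_mult distrib_left)
  finally show ?thesis .
qed

section \<open>The kernel integral\<close>

text \<open>The lower regularity bound and finiteness of \<open>M\<close> force the diameter to be finite. Regularity
  speaks only of radii strictly below the diameter, whereas the dyadic decomposition starts with the
  ball of radius \<open>D\<close>; its mass is at most that of the whole space, and enlarging the constant
  extends the upper bound to \<open>r = D\<close>.\<close>

lemma ahlfors_regular_growth:
  fixes M :: "'a::{metric_space, second_countable_topology} measure"
  assumes "\<delta> > 0" "finite_measure M" "ahlfors_regular \<delta> M"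
  obtains D A where "0 \<le> D" "ediam (UNIV :: 'a set) = ennreal D" "0 \<le> A"
    "\<And>(x::'a) r. 0 < r \<Longrightarrow> r \<le> D \<Longrightarrow> measure M (cball x r) \<le> A * r powr \<delta>"
proof -
  interpret finite_measure M by fact
  let ?m = "measure M (space M)"
  obtain C where C: "C \<ge> 1"
    and lower: "\<And>(x::'a) r. 0 \<le> r \<Longrightarrow> ennreal r < ediam (UNIV :: 'a set) \<Longrightarrow>
       inverse C * r powr \<delta> \<le> measure M (cball x r)"
    and upper: "\<And>(x::'a) r. 0 \<le> r \<Longrightarrow> ennreal r < ediam (UNIV :: 'a set) \<Longrightarrow>
       measure M (cball x r) \<le> C * r powr \<delta>"
    using assms(3) unfolding ahlfors_regular_def by blast
  have "ediam (UNIV :: 'a set) \<noteq> top"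
  proof
    assume top: "ediam (UNIV :: 'a set) = top"
    \<comment> \<open>The lower bound at this radius exceeds the total mass by one.\<close>
    define r where "r = (C * (?m + 1)) powr (1 / \<delta>)"
    have "r powr \<delta> = C * (?m + 1)"
      using assms(1) C by (simp add: r_def powr_powr)
    moreover have "inverse C * r powr \<delta> \<le> measure M (cball (undefined::'a) r)"
      by (rule lower) (simp_all add: r_def top)
    moreover have "measure M (cball (undefined::'a) r) \<le> ?m"
      by (rule bounded_measure)
    moreover have "inverse C * (C * (?m + 1)) = ?m + 1"
      using C by simp
    ultimately show False by simp
  qed
  then obtain D where D: "0 \<le> D" "ediam (UNIV :: 'a set) = ennreal D"
    by (cases "ediam (UNIV :: 'a set)") auto
  define A where "A = max C (?m / D powr \<delta>)"
  show thesis
  proof (rule that[OF D])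
    show "0 \<le> A" using C by (simp add: A_def)
    fix x :: 'a and r :: real
    assume r: "0 < r" "r \<le> D"
    show "measure M (cball x r) \<le> A * r powr \<delta>"
    proof (cases "r = D")
      case True
      have "measure M (cball x r) \<le> ?m / D powr \<delta> * r powr \<delta>"
        using True r bounded_measure[of "cball x r"] by simp
      also have "\<dots> \<le> A * r powr \<delta>"
        by (intro mult_right_mono) (simp_all add: A_def)
      finally show ?thesis .
    next
      case False
      then have "measure M (cball x r) \<le> C * r powr \<delta>"
        using r D by (intro upper) (simp_all add: ennreal_less_iff)
      also have "\<dots> \<le> A * r powr \<delta>"
        by (intro mult_right_mono) (simp_all add: A_def)
      finally show ?thesis .
    qed
  qed
qed

text \<open>The kernel on the annulus with radii \<open>(1/2) ^ Suc n * D\<close> and \<open>(1/2) ^ n * D\<close> is at most its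
  value at the inner radius, and the annulus lies in the ball of the outer radius, whose measure is
  at most \<open>2 powr \<delta> * A\<close> times the reciprocal of that value. Only upper bounds are needed, so the
  overlapping balls replace the annuli.\<close>

lemma nn_integral_kernel_le:
  fixes h :: "'a::metric_space \<Rightarrow> real" and w :: "nat \<Rightarrow> real"
  assumes "finite_measure M" and sets: "sets M = sets borel"
    and \<delta>: "0 \<le> \<delta>" and A: "0 \<le> A"
    and diam: "\<And>y. dist x y \<le> D"
    and growth: "\<And>r. 0 < r \<Longrightarrow> r \<le> D \<Longrightarrow> measure M (cball x r) \<le> A * r powr \<delta>"
    and w0: "\<And>n. 0 \<le> w n"
    and w: "\<And>n y. dist x y \<le> (1/2) ^ n * D \<Longrightarrow> \<bar>h x - h y\<bar> \<le> w n"
  shows "(\<integral>\<^sup>+y. ennreal (\<bar>h x - h y\<bar> / dist x y powr \<delta>) \<partial>M)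
    \<le> ennreal (2 powr \<delta> * A) * (\<Sum>n. ennreal (w n))"
proof (cases "D > 0")
  case False
  \<comment> \<open>Here the space is a single point, and division by \<open>0 powr \<delta> = 0\<close> gives \<open>0\<close>.\<close>
  have "\<bar>h x - h y\<bar> / dist x y powr \<delta> = 0" for y
  proof -
    have "dist x y = 0"
      using False diam[of y] zero_le_dist[of x y] by linarith
    then show ?thesis by simp
  qed
  then have "(\<integral>\<^sup>+y. ennreal (\<bar>h x - h y\<bar> / dist x y powr \<delta>) \<partial>M) = 0"
    by (simp only: ennreal_0 nn_integral_const mult_zero_left)
  then show ?thesis by simp
next
  case D: True
  interpret finite_measure M by fact
  have term_le_suminf: "F n \<le> (\<Sum>n. F n)" for F :: "nat \<Rightarrow> ennreal" and n
    using sum_le_suminf[of F "{n}"] by simp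
  define c where "c n = w n / ((1/2) ^ Suc n * D) powr \<delta>" for n
  define B where "B n = cball x ((1/2) ^ n * D)" for n
  have B [measurable]: "B n \<in> sets M" for n
    unfolding B_def sets by simp
  have "(\<integral>\<^sup>+y. ennreal (\<bar>h x - h y\<bar> / dist x y powr \<delta>) \<partial>M)
      \<le> (\<integral>\<^sup>+y. (\<Sum>n. ennreal (c n) * indicator (B n) y) \<partial>M)"
  proof (intro nn_integral_mono)
    fix y
    show "ennreal (\<bar>h x - h y\<bar> / dist x y powr \<delta>) \<le> (\<Sum>n. ennreal (c n) * indicator (B n) y)"
    proof (cases "x = y")
      case False
      then obtain n where n: "(1/2) ^ Suc n < dist x y / D" "dist x y / D \<le> (1/2) ^ n"
        using dyadic_scale_exists[of "dist x y / D"] diam[of y] D by auto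
      then have lo: "(1/2) ^ Suc n * D < dist x y" and hi: "dist x y \<le> (1/2) ^ n * D"
        using D by (simp_all add: less_divide_eq divide_le_eq)
      have "\<bar>h x - h y\<bar> / dist x y powr \<delta> \<le> c n"
        unfolding c_def
        by (intro frac_le w hi w0 powr_mono2) (use lo D \<delta> in auto)
      then have "ennreal (\<bar>h x - h y\<bar> / dist x y powr \<delta>) \<le> ennreal (c n) * indicator (B n) y"
        using hi by (simp add: B_def ennreal_leI)
      also have "\<dots> \<le> (\<Sum>n. ennreal (c n) * indicator (B n) y)"
        by (rule term_le_suminf)
      finally show ?thesis .
    qed simp
  qed
  also have "\<dots> = (\<Sum>n. ennreal (c n) * emeasure M (B n))"
    by (subst nn_integral_suminf) (simp_all add: nn_integral_cmult_indicator)
  also have "\<dots> \<le> (\<Sum>n. ennreal (2 powr \<delta> * A) * ennreal (w n))"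
  proof (intro suminf_le)
    fix n
    define r where "r = (1/2) ^ Suc n * D"
    have r: "0 < r" using D by (simp add: r_def)
    have "2 * r = (1/2) ^ n * D" by (simp add: r_def)
    moreover have "(1/2) ^ n * D \<le> 1 * D"
      by (intro mult_right_mono power_le_one) (use D in auto)
    ultimately have "measure M (B n) \<le> A * (2 * r) powr \<delta>"
      unfolding B_def using growth[of "2 * r"] r by simp
    then have "measure M (B n) \<le> A * (2 powr \<delta> * r powr \<delta>)"
      using r by (simp add: powr_mult)
    then have "c n * measure M (B n) \<le> c n * (A * (2 powr \<delta> * r powr \<delta>))"
      by (intro mult_left_mono) (simp_all add: c_def w0)
    also have "\<dots> = 2 powr \<delta> * A * w n"
      unfolding c_def r_def[symmetric] using r by simp
    finally have "ennreal (c n * measure M (B n)) \<le> ennreal (2 powr \<delta> * A * w n)"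
      by (rule ennreal_leI)
    then show "ennreal (c n) * emeasure M (B n) \<le> ennreal (2 powr \<delta> * A) * ennreal (w n)"
      using A w0[of n] by (simp add: emeasure_eq_measure c_def flip: ennreal_mult)
  qed simp_all
  also have "\<dots> = ennreal (2 powr \<delta> * A) * (\<Sum>n. ennreal (w n))"
    by (rule ennreal_suminf_cmult)
  finally show ?thesis .
qed

text \<open>This is where the quadratic dependence on the Dini norm arises: one increment of \<open>h\<close> costs a
  supremum, the other the dyadic sum of the modulus.\<close>

lemma nn_integral_square_kernel_le:
  fixes h :: "'a::metric_space \<Rightarrow> real"
  assumes "finite_measure M" and sets: "sets M = sets borel"
    and "0 \<le> \<delta>" and A: "0 \<le> A"
    and D: "0 \<le> D" "ediam (UNIV :: 'a set) = ennreal D"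
    and growth: "\<And>r. 0 < r \<Longrightarrow> r \<le> D \<Longrightarrow> measure M (cball x r) \<le> A * r powr \<delta>"
    and S: "\<And>y. \<bar>h y\<bar> \<le> S"
    and [measurable]: "h \<in> borel_measurable M"
    and [measurable]: "(\<lambda>y. dist x y) \<in> borel_measurable M"
  shows "(\<integral>\<^sup>+y. ennreal ((h x - h y)\<^sup>2 / dist x y powr \<delta>) \<partial>M)
    \<le> ennreal (2 * S) * (ennreal (2 powr \<delta> * A) * (2 * (ennreal S + Din h)))"
proof -
  have S0: "0 \<le> S" using S[of undefined] by linarith
  have diam: "dist x y \<le> D" for y
  proof -
    have "ennreal (dist x y) \<le> ediam (UNIV :: 'a set)"
      unfolding ediam_def by (rule SUP_upper2[of "(x, y)"]) auto
    with D show ?thesis by simp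
  qed
  have "(\<integral>\<^sup>+y. ennreal ((h x - h y)\<^sup>2 / dist x y powr \<delta>) \<partial>M)
      \<le> (\<integral>\<^sup>+y. ennreal (2 * S) * ennreal (\<bar>h x - h y\<bar> / dist x y powr \<delta>) \<partial>M)"
  proof (intro nn_integral_mono)
    fix y
    have "(h x - h y)\<^sup>2 = \<bar>h x - h y\<bar> * \<bar>h x - h y\<bar>"
      by (simp add: power2_eq_square)
    also have "\<dots> \<le> 2 * S * \<bar>h x - h y\<bar>"
      by (intro mult_right_mono abs_diff_le_bound S) simp
    finally have "(h x - h y)\<^sup>2 / dist x y powr \<delta> \<le> 2 * S * \<bar>h x - h y\<bar> / dist x y powr \<delta>"
      by (intro divide_right_mono) simp_all
    then show "ennreal ((h x - h y)\<^sup>2 / dist x y powr \<delta>)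
        \<le> ennreal (2 * S) * ennreal (\<bar>h x - h y\<bar> / dist x y powr \<delta>)"
      using S0 by (simp add: ennreal_leI flip: ennreal_mult)
  qed
  also have "\<dots> = ennreal (2 * S) * (\<integral>\<^sup>+y. ennreal (\<bar>h x - h y\<bar> / dist x y powr \<delta>) \<partial>M)"
    by (rule nn_integral_cmult) measurable
  also have "(\<integral>\<^sup>+y. ennreal (\<bar>h x - h y\<bar> / dist x y powr \<delta>) \<partial>M)
      \<le> ennreal (2 powr \<delta> * A) * (\<Sum>n. ennreal (modulus_cont h ((1/2) ^ n)))"
  proof (rule nn_integral_kernel_le[OF assms(1-4) diam growth])
    show "0 \<le> modulus_cont h ((1/2) ^ n)" for n
      by (rule modulus_cont_nonneg[OF S])
    show "\<bar>h x - h y\<bar> \<le> modulus_cont h ((1/2) ^ n)" if "dist x y \<le> (1/2) ^ n * D" for n y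
      by (rule abs_diff_le_modulus_cont[OF S]) (use that in \<open>simp add: dist_le_scaled_ediam_iff[OF D(2,1)]\<close>)
  qed
  also have "(\<Sum>n. ennreal (modulus_cont h ((1/2) ^ n))) \<le> 2 * (ennreal S + Din h)"
    by (rule suminf_modulus_cont_le[OF S])
  finally show ?thesis by (simp add: mult_left_mono)
qed

section \<open>The energy as an extended nonnegative integral\<close>

text \<open>Twice the value of the form on the diagonal. The diagonal of the product need not be removed
  here: the integrand vanishes on it, because its numerator does.\<close>

definition energy :: "real \<Rightarrow> 'a::metric_space measure \<Rightarrow> ('a \<Rightarrow> real) \<Rightarrow> ennreal" where
  "energy \<delta> M f = (\<integral>\<^sup>+x. (\<integral>\<^sup>+y. ennreal ((f x - f y)\<^sup>2 / dist x y powr \<delta>) \<partial>M) \<partial>M)"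

lemma form_dom_iff_energy:
  "f \<in> form_dom \<delta> M \<longleftrightarrow> f \<in> L2_space M \<and> energy \<delta> M f < \<infinity>"
proof -
  have "ennreal (\<bar>f x - f y\<bar>\<^sup>2 / dist x y powr \<delta>) * indicator (-{x}) y
      = ennreal ((f x - f y)\<^sup>2 / dist x y powr \<delta>)" for x y
    by (auto simp: indicator_def)
  then show ?thesis by (simp add: form_dom_def energy_def)
qed

text \<open>The Bochner integrals in the form would be \<open>0\<close> by default if they diverged, so finite energy
  is essential. It makes the inner integral finite for almost every \<open>x\<close>, and there the conversions
  between \<open>ennreal\<close> and \<open>real\<close> lose nothing.\<close>

lemma form_eq_energy:
  fixes M :: "'a::{metric_space, second_countable_topology} measure"
  assumes "finite_measure M" and sets [measurable_cong]: "sets M = sets borel"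
    and f: "f \<in> form_dom \<delta> M"
  shows "form \<delta> M f f = enn2real (energy \<delta> M f) / 2"
proof -
  interpret finite_measure M by fact
  have [measurable]: "f \<in> borel_measurable M"
    using f by (simp add: form_dom_def L2_space_def)
  define J where "J x = (\<integral>\<^sup>+y. ennreal ((f x - f y)\<^sup>2 / dist x y powr \<delta>) \<partial>M)" for x
  have [measurable]: "J \<in> borel_measurable M"
    unfolding J_def by measurable
  have fin: "(\<integral>\<^sup>+x. J x \<partial>M) < \<infinity>"
    using f by (simp add: form_dom_iff_energy energy_def J_def)
  have inner: "(LINT y:-{x}|M. (f x - f y) * (f x - f y) / dist x y powr \<delta>) = enn2real (J x)" for x
  proof -
    have "(LINT y:-{x}|M. (f x - f y) * (f x - f y) / dist x y powr \<delta>)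
        = (\<integral>y. (f x - f y)\<^sup>2 / dist x y powr \<delta> \<partial>M)"
      unfolding set_lebesgue_integral_def
      by (intro Bochner_Integration.integral_cong) (auto simp: indicator_def power2_eq_square)
    also have "\<dots> = enn2real (J x)"
      unfolding J_def by (rule integral_eq_nn_integral) simp_all
    finally show ?thesis .
  qed
  have "(\<integral>x. enn2real (J x) \<partial>M) = enn2real (\<integral>\<^sup>+x. ennreal (enn2real (J x)) \<partial>M)"
    by (rule integral_eq_nn_integral) simp_all
  also have "(\<integral>\<^sup>+x. ennreal (enn2real (J x)) \<partial>M) = (\<integral>\<^sup>+x. J x \<partial>M)"
  proof (rule nn_integral_cong_AE)
    have "AE x in M. J x \<noteq> \<infinity>"
      using fin by (intro nn_integral_noteq_infinite) auto
    then show "AE x in M. ennreal (enn2real (J x)) = J x"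
      by eventually_elim (simp add: ennreal_enn2real_if)
  qed
  finally show ?thesis
    unfolding form_def inner by (simp add: energy_def J_def)
qed

text \<open>A product rule for increments, combined with \<open>(a + b)\<^sup>2 \<le> 2 * a\<^sup>2 + 2 * b\<^sup>2\<close>. The factor \<open>f x\<close>
  in the second term depends only on the outer variable, so the inner integral sees nothing but the
  kernel integral of \<open>h\<close>.\<close>

lemma energy_mult_le:
  fixes M :: "'a::{metric_space, second_countable_topology} measure"
  assumes "finite_measure M" and sets [measurable_cong]: "sets M = sets borel"
    and [measurable]: "f \<in> borel_measurable M"
    and [measurable]: "h \<in> borel_measurable M"
    and S: "\<And>x. \<bar>h x\<bar> \<le> S"
    and K: "\<And>x. (\<integral>\<^sup>+y. ennreal ((h x - h y)\<^sup>2 / dist x y powr \<delta>) \<partial>M) \<le> K"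
  shows "energy \<delta> M (\<lambda>x. h x * f x)
    \<le> ennreal (2 * S\<^sup>2) * energy \<delta> M f + 2 * K * (\<integral>\<^sup>+x. ennreal ((f x)\<^sup>2) \<partial>M)"
proof -
  interpret finite_measure M by fact
  let ?q = "\<lambda>g x y. ennreal ((g x - g y)\<^sup>2 / dist x y powr \<delta>)"
  have pointwise: "?q (\<lambda>x. h x * f x) x y
      \<le> ennreal (2 * S\<^sup>2) * ?q f x y + ennreal (2 * (f x)\<^sup>2) * ?q h x y" for x y
  proof -
    let ?a = "h y * (f x - f y)" and ?b = "f x * (h x - h y)"
    have "(h x * f x - h y * f y)\<^sup>2 = (?a + ?b)\<^sup>2"
      by (simp add: algebra_simps)
    also have "\<dots> \<le> 2 * ?a\<^sup>2 + 2 * ?b\<^sup>2"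
      using zero_le_power2[of "?a - ?b"] by (simp only: power2_sum power2_diff)
    also have "\<dots> = 2 * (h y)\<^sup>2 * (f x - f y)\<^sup>2 + 2 * (f x)\<^sup>2 * (h x - h y)\<^sup>2"
      by (simp add: power_mult_distrib)
    also have "\<dots> \<le> 2 * S\<^sup>2 * (f x - f y)\<^sup>2 + 2 * (f x)\<^sup>2 * (h x - h y)\<^sup>2"
    proof -
      have "(h y)\<^sup>2 \<le> S\<^sup>2" using S[of y] by (simp add: abs_le_square_iff[symmetric])
      then show ?thesis by (intro add_right_mono mult_right_mono) auto
    qed
    finally have "(h x * f x - h y * f y)\<^sup>2 / dist x y powr \<delta>
        \<le> (2 * S\<^sup>2 * (f x - f y)\<^sup>2 + 2 * (f x)\<^sup>2 * (h x - h y)\<^sup>2) / dist x y powr \<delta>"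
      by (intro divide_right_mono) simp_all
    also have "\<dots> = 2 * S\<^sup>2 * ((f x - f y)\<^sup>2 / dist x y powr \<delta>)
        + 2 * (f x)\<^sup>2 * ((h x - h y)\<^sup>2 / dist x y powr \<delta>)"
      by (simp add: add_divide_distrib)
    finally show ?thesis
      by (simp add: ennreal_leI flip: ennreal_mult ennreal_plus)
  qed
  have "energy \<delta> M (\<lambda>x. h x * f x) \<le> (\<integral>\<^sup>+x. (\<integral>\<^sup>+y. ennreal (2 * S\<^sup>2) * ?q f x y
      + ennreal (2 * (f x)\<^sup>2) * ?q h x y \<partial>M) \<partial>M)"
    unfolding energy_def by (intro nn_integral_mono pointwise)
  also have "\<dots> = (\<integral>\<^sup>+x. ennreal (2 * S\<^sup>2) * (\<integral>\<^sup>+y. ?q f x y \<partial>M)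
      + ennreal (2 * (f x)\<^sup>2) * (\<integral>\<^sup>+y. ?q h x y \<partial>M) \<partial>M)"
    by (subst nn_integral_add, measurable) (simp add: nn_integral_cmult)
  also have "\<dots> \<le> (\<integral>\<^sup>+x. ennreal (2 * S\<^sup>2) * (\<integral>\<^sup>+y. ?q f x y \<partial>M)
      + 2 * K * ennreal ((f x)\<^sup>2) \<partial>M)"
  proof (intro nn_integral_mono add_left_mono)
    fix x
    have "ennreal (2 * (f x)\<^sup>2) * (\<integral>\<^sup>+y. ?q h x y \<partial>M) \<le> ennreal (2 * (f x)\<^sup>2) * K"
      by (intro mult_left_mono K) simp
    then show "ennreal (2 * (f x)\<^sup>2) * (\<integral>\<^sup>+y. ?q h x y \<partial>M) \<le> 2 * K * ennreal ((f x)\<^sup>2)"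
      by (simp add: ennreal_mult mult_ac)
  qed
  also have "\<dots> = ennreal (2 * S\<^sup>2) * energy \<delta> M f + 2 * K * (\<integral>\<^sup>+x. ennreal ((f x)\<^sup>2) \<partial>M)"
    unfolding energy_def by (subst nn_integral_add, measurable) (simp add: nn_integral_cmult)
  finally show ?thesis .
qed

section \<open>Multiplication by Dini continuous functions\<close>

lemma L2_mult_bounded:
  assumes f: "f \<in> L2_space M" and [measurable]: "h \<in> borel_measurable M"
    and S: "\<And>x. \<bar>h x\<bar> \<le> S"
  shows "(\<lambda>x. h x * f x) \<in> L2_space M"
    and "(L2_norm M (\<lambda>x. h x * f x))\<^sup>2 \<le> S\<^sup>2 * (L2_norm M f)\<^sup>2"
proof -
  have [measurable]: "f \<in> borel_measurable M" and int: "integrable M (\<lambda>x. (f x)\<^sup>2)"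
    using f by (auto simp: L2_space_def)
  have int': "integrable M (\<lambda>x. S\<^sup>2 * (f x)\<^sup>2)" using int by simp
  have le: "(h x * f x)\<^sup>2 \<le> S\<^sup>2 * (f x)\<^sup>2" for x
    using S[of x] by (simp add: power_mult_distrib mult_right_mono abs_le_square_iff[symmetric])
  have hf: "integrable M (\<lambda>x. (h x * f x)\<^sup>2)"
    by (rule Bochner_Integration.integrable_bound[OF int']) (use le in auto)
  then show "(\<lambda>x. h x * f x) \<in> L2_space M" by (simp add: L2_space_def)
  have "(\<integral>x. (h x * f x)\<^sup>2 \<partial>M) \<le> (\<integral>x. S\<^sup>2 * (f x)\<^sup>2 \<partial>M)"
    by (intro integral_mono hf int' le)
  then show "(L2_norm M (\<lambda>x. h x * f x))\<^sup>2 \<le> S\<^sup>2 * (L2_norm M f)\<^sup>2"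
    by (simp add: L2_norm_def)
qed

theorem lemma4p6:
  fixes M :: "'a::{metric_space, second_countable_topology} measure" and \<delta> :: real
  assumes "\<delta> > 0" and "metric_measure_space M" and "ahlfors_regular \<delta> M"
  shows "\<exists>C>0. \<forall>h f. dini_continuous h \<longrightarrow> f \<in> form_dom \<delta> M \<longrightarrow>
           (\<lambda>x. h x * f x) \<in> form_dom \<delta> M \<and>
           form_norm \<delta> M (\<lambda>x. h x * f x) \<le> C * dini_norm h * form_norm \<delta> M f"
proof -
  have finM: "finite_measure M" and sets: "sets M = sets borel"
    using assms(2) by (auto simp: metric_measure_space_def)
  note [measurable_cong] = sets
  obtain D A where D: "0 \<le> D" "ediam (UNIV :: 'a set) = ennreal D" and A: "0 \<le> A"
    and growth: "\<And>(x::'a) r. 0 < r \<Longrightarrow> r \<le> D \<Longrightarrow> measure M (cball x r) \<le> A * r powr \<delta>"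
    using ahlfors_regular_growth[OF assms(1) finM assms(3)] by blast
  \<comment> \<open>The kernel integral of \<open>h\<close> is at most \<open>B\<close> times the square of its Dini norm: the supremum
    and the dyadic sum contribute a factor \<open>2\<close> each.\<close>
  define B where "B = 4 * (2 powr \<delta> * A)"
  have B: "0 \<le> B" using A by (simp add: B_def)
  show ?thesis
  proof (intro exI[of _ "sqrt (2 + B)"] conjI allI impI)
    show "0 < sqrt (2 + B)" using B by simp
    fix h f :: "'a \<Rightarrow> real"
    assume h: "dini_continuous h" and f: "f \<in> form_dom \<delta> M"
    have fL2: "f \<in> L2_space M" and fe: "energy \<delta> M f < \<infinity>"
      using f by (simp_all add: form_dom_iff_energy)
    have [measurable]: "f \<in> borel_measurable M" and fint: "integrable M (\<lambda>x. (f x)\<^sup>2)"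
      using fL2 by (auto simp: L2_space_def)
    have "continuous_on UNIV h"
      using h by (auto simp: dini_continuous_def intro: uniformly_continuous_imp_continuous)
    then have hm [measurable]: "h \<in> borel_measurable M"
      by (simp add: borel_measurable_continuous_onI measurable_cong_sets[OF sets refl])
    define S where "S = (SUP x. \<bar>h x\<bar>)"
    \<comment> \<open>Boundedness of \<open>h\<close> keeps the supremum in the Dini norm from being an unspecified real.\<close>
    have "bdd_above (range (\<lambda>x. \<bar>h x\<bar>))"
      using h by (auto simp: dini_continuous_def bounded_iff intro: bdd_aboveI)
    then have S: "\<bar>h x\<bar> \<le> S" for x
      unfolding S_def by (rule cSUP_upper[OF UNIV_I])
    have S0: "0 \<le> S" using S[of undefined] by linarith
    define N where "N = dini_norm h"
    have N: "N = S + enn2real (Din h)" by (simp add: N_def dini_norm_def S_def)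
    have SN: "S \<le> N" by (simp add: N)
    have "Din h < \<infinity>" using h by (simp add: dini_continuous_def)
    then have N_ennreal: "ennreal S + Din h = ennreal N"
      using S0 by (simp add: N ennreal_enn2real_if)
    have S2: "S\<^sup>2 \<le> N\<^sup>2" using SN S0 by (intro power_mono)
    define q where "q = (L2_norm M f)\<^sup>2"
    define e where "e = enn2real (energy \<delta> M f)"
    have q0: "0 \<le> q" and e0: "0 \<le> e" by (simp_all add: q_def e_def)
    have q: "(\<integral>\<^sup>+x. ennreal ((f x)\<^sup>2) \<partial>M) = ennreal q"
      using fint by (simp add: q_def L2_norm_def nn_integral_eq_integral)
    have e: "energy \<delta> M f = ennreal e" using fe by (simp add: e_def ennreal_enn2real_if)
    have kernel: "(\<integral>\<^sup>+y. ennreal ((h x - h y)\<^sup>2 / dist x y powr \<delta>) \<partial>M) \<le> ennreal (B * N\<^sup>2)" for x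
    proof -
      have "(\<integral>\<^sup>+y. ennreal ((h x - h y)\<^sup>2 / dist x y powr \<delta>) \<partial>M)
          \<le> ennreal (2 * S) * (ennreal (2 powr \<delta> * A) * (2 * (ennreal S + Din h)))"
        by (rule nn_integral_square_kernel_le[OF finM sets _ A D growth S])
          (use assms(1) in \<open>simp_all\<close>)
      also have "\<dots> = ennreal (2 * S * (2 powr \<delta> * A * (2 * N)))"
      proof -
        have "2 * ennreal N = ennreal (2 * N)"
          using SN S0 by (simp add: ennreal_mult)
        then show ?thesis
          unfolding N_ennreal using S0 SN A by (simp flip: ennreal_mult)
      qed
      also have "\<dots> = ennreal (B * (S * N))"
        by (simp add: B_def mult_ac)
      also have "\<dots> \<le> ennreal (B * N\<^sup>2)"
        using B SN S0 by (intro ennreal_leI mult_left_mono) (simp_all add: power2_eq_square mult_right_mono)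
      finally show ?thesis .
    qed
    have "energy \<delta> M (\<lambda>x. h x * f x)
        \<le> ennreal (2 * S\<^sup>2) * energy \<delta> M f + 2 * ennreal (B * N\<^sup>2) * (\<integral>\<^sup>+x. ennreal ((f x)\<^sup>2) \<partial>M)"
      by (rule energy_mult_le[OF finM sets _ hm S kernel]) measurable
    also have "\<dots> = ennreal (2 * S\<^sup>2 * e + 2 * (B * N\<^sup>2) * q)"
      unfolding e q using e0 q0 B by (simp add: ennreal_mult ennreal_plus)
    finally have energy: "energy \<delta> M (\<lambda>x. h x * f x) \<le> ennreal (2 * S\<^sup>2 * e + 2 * (B * N\<^sup>2) * q)" .
    show dom: "(\<lambda>x. h x * f x) \<in> form_dom \<delta> M"
      unfolding form_dom_iff_energy
      using L2_mult_bounded(1)[OF fL2 hm S] energy by (auto intro: le_less_trans)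
    have "enn2real (energy \<delta> M (\<lambda>x. h x * f x)) \<le> 2 * S\<^sup>2 * e + 2 * (B * N\<^sup>2) * q"
      using energy e0 q0 B by (intro enn2real_leI) auto
    then have "(L2_norm M (\<lambda>x. h x * f x))\<^sup>2 + form \<delta> M (\<lambda>x. h x * f x) (\<lambda>x. h x * f x)
        \<le> S\<^sup>2 * q + (S\<^sup>2 * e + B * N\<^sup>2 * q)"
      using L2_mult_bounded(2)[OF fL2 hm S]
      unfolding form_eq_energy[OF finM sets dom] q_def by linarith
    also have "\<dots> \<le> N\<^sup>2 * q + (N\<^sup>2 * e + B * N\<^sup>2 * q)"
      by (intro add_mono mult_right_mono S2 q0 e0 order_refl)
    also have "\<dots> \<le> (2 + B) * N\<^sup>2 * (q + e / 2)"
    proof -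
      have "0 \<le> N\<^sup>2 * q" "0 \<le> B * N\<^sup>2 * e" using q0 e0 B by simp_all
      then show ?thesis by (simp add: algebra_simps)
    qed
    also have "q + e / 2 = (L2_norm M f)\<^sup>2 + form \<delta> M f f"
      by (simp add: q_def e_def form_eq_energy[OF finM sets f])
    finally have "form_norm \<delta> M (\<lambda>x. h x * f x)
        \<le> sqrt ((2 + B) * N\<^sup>2 * ((L2_norm M f)\<^sup>2 + form \<delta> M f f))"
      unfolding form_norm_def by (rule real_sqrt_le_mono)
    also have "\<dots> = sqrt (2 + B) * N * form_norm \<delta> M f"
      using SN S0 by (simp add: form_norm_def real_sqrt_mult)
    finally show "form_norm \<delta> M (\<lambda>x. h x * f x)
        \<le> sqrt (2 + B) * dini_norm h * form_norm \<delta> M f"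
      by (simp add: N_def)
  qed
qed

end
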